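(* Let $n\ge 2$, let $\mathfrak p\subset\mathfrak{sl}_n(\mathbb C)$ be the first maximal parabolic subalgebra, and let $F=e_{12}^*+e_{23}^*+\dots+e_{n-1,n}^*$, a Frobenius functional on $\mathfrak p$. Then the principal element of $F$ is $$\widehat F=\tfrac12\bigl[(n-1)e_{11}+(n-3)e_{22}+\dots+(1-n)e_{nn}\bigr],$$ which is half of the semisimple element $\operatorname{diag}(n-1,n-3,\dots,1-n)$ of the principal three-dimensional subalgebra of $\mathfrak{sl}_n$. The eigenvalues of $\operatorname{ad}\widehat F$ on $\mathfrak p$ are $n-1,n-2,\dots,2-n$.
   Context: For a finite-dimensional complex Lie algebra $\mathfrak f$ and $F\in\mathfrak f^*$, $F$ is a Frobenius functional if the skew-symmetric form $B_F(x,y)=F([x,y])$ on $\mathfrak f$ is non-degenerate; its principal element is then the unique $\widehat F\in\mathfrak f$ with $F(x)=F([\widehat F,x])$ for all $x\in\mathfrak f$. Let $e_{ij}$ be the $n\times n$ matrix units and $e_{ij}^*$ the functional giving the $(i,j)$ entry of a matrix. The first maximal parabolic subalgebra $\mathfrak p$ of $\mathfrak{sl}_n$ is the one obtained by deleting the first negative simple root, i.e. the traceless matrices whose entries in positions $(2,1),(3,1),\dots,(n,1)$ are all zero. It is a known fact that the restriction of the functional $e_{12}^*+e_{23}^*+\dots+e_{n-1,n}^*$ to $\mathfrak p$ is a Frobenius functional. The principal three-dimensional subalgebra of $\mathfrak{sl}_n$ (Kostant) is the $\mathfrak{sl}_2$-subalgebra spanned by a standard triple $(e,h,f)$ whose nilpotent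 element is $e=\sum_{i=1}^{n-1}e_{i,i+1}$ and whose semisimple element is $h=\operatorname{diag}(n-1,n-3,\dots,1-n)$. *)

theory Defs
  imports Complex_Main "Jordan_Normal_Form.Matrix"
begin

(* All matrix indices are 0-based: the matrix unit e_ij corresponds to position (i-1, j-1). *)

definition lie_bracket :: "complex mat \<Rightarrow> complex mat \<Rightarrow> complex mat" where
  "lie_bracket A B = A * B - B * A"

definition mat_trace :: "complex mat \<Rightarrow> complex" where
  "mat_trace A = (\<Sum>i<dim_row A. A $$ (i, i))"

definition sl :: "nat \<Rightarrow> complex mat set" where
  "sl n = {A \<in> carrier_mat n n. mat_trace A = 0}"

definition first_max_parabolic :: "nat \<Rightarrow> complex mat set" where
  "first_max_parabolic n = {A \<in> sl n. \<forall>i. 0 < i \<and> i < n \<longrightarrow> A $$ (i, 0) = 0}"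

definition lie_subalgebra :: "nat \<Rightarrow> complex mat set \<Rightarrow> bool" where
  "lie_subalgebra n L \<longleftrightarrow>
     L \<subseteq> carrier_mat n n \<and> 0\<^sub>m n n \<in> L \<and>
     (\<forall>x\<in>L. \<forall>y\<in>L. x + y \<in> L) \<and>
     (\<forall>c. \<forall>x\<in>L. c \<cdot>\<^sub>m x \<in> L) \<and>
     (\<forall>x\<in>L. \<forall>y\<in>L. lie_bracket x y \<in> L)"

(* Only the values of F on L matter: an element of the dual of L is represented by any
   function on matrices whose restriction to L is linear. *)
definition linear_functional_on :: "complex mat set \<Rightarrow> (complex mat \<Rightarrow> complex) \<Rightarrow> bool" where
  "linear_functional_on L F \<longleftrightarrow>
     (\<forall>x\<in>L. \<forall>y\<in>L. F (x + y) = F x + F y) \<and>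
     (\<forall>c. \<forall>x\<in>L. F (c \<cdot>\<^sub>m x) = c * F x)"

definition frobenius_functional ::
  "nat \<Rightarrow> complex mat set \<Rightarrow> (complex mat \<Rightarrow> complex) \<Rightarrow> bool" where
  "frobenius_functional n L F \<longleftrightarrow>
     lie_subalgebra n L \<and> linear_functional_on L F \<and>
     (\<forall>x\<in>L. (\<forall>y\<in>L. F (lie_bracket x y) = 0) \<longrightarrow> x = 0\<^sub>m n n)"

(* Meaningful when F is a Frobenius functional on L, which makes the element exist uniquely. *)
definition principal_element ::
  "complex mat set \<Rightarrow> (complex mat \<Rightarrow> complex) \<Rightarrow> complex mat" where
  "principal_element L F = (THE h. h \<in> L \<and> (\<forall>x\<in>L. F x = F (lie_bracket h x)))"

definition superdiagonal_functional :: "nat \<Rightarrow> complex mat \<Rightarrow> complex" where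
  "superdiagonal_functional n A = (\<Sum>i<n - 1. A $$ (i, i + 1))"

definition principal_nilpotent :: "nat \<Rightarrow> complex mat" where
  "principal_nilpotent n = mat n n (\<lambda>(i, j). if j = i + 1 then 1 else 0)"

definition principal_semisimple :: "nat \<Rightarrow> complex mat" where
  "principal_semisimple n = mat_diag n (\<lambda>i. of_int (int n - 1 - 2 * int i))"

definition standard_triple ::
  "nat \<Rightarrow> complex mat \<Rightarrow> complex mat \<Rightarrow> complex mat \<Rightarrow> bool" where
  "standard_triple n e h f \<longleftrightarrow>
     e \<in> sl n \<and> h \<in> sl n \<and> f \<in> sl n \<and> e \<noteq> 0\<^sub>m n n \<and>
     lie_bracket h e = 2 \<cdot>\<^sub>m e \<and>
     lie_bracket h f = (- 2) \<cdot>\<^sub>m f \<and>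
     lie_bracket e f = h"

(* S is the principal three-dimensional subalgebra of sl n, with semisimple element h. *)
definition principal_tds :: "nat \<Rightarrow> complex mat set \<Rightarrow> complex mat \<Rightarrow> bool" where
  "principal_tds n S h \<longleftrightarrow>
     h = principal_semisimple n \<and>
     (\<exists>f. standard_triple n (principal_nilpotent n) h f \<and>
          S = {a \<cdot>\<^sub>m principal_nilpotent n + b \<cdot>\<^sub>m h + c \<cdot>\<^sub>m f | a b c. True})"

definition eigenvalues_on ::
  "nat \<Rightarrow> complex mat set \<Rightarrow> (complex mat \<Rightarrow> complex mat) \<Rightarrow> complex set" where
  "eigenvalues_on n L T = {c. \<exists>x\<in>L. x \<noteq> 0\<^sub>m n n \<and> T x = c \<cdot>\<^sub>m x}"

end

theory Submission
  imports Defs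
begin

text \<open>
  Nondegeneracy: let \<open>x\<close> be orthogonal to the whole parabolic. Bracketing with diagonal matrices
  shows that the superdiagonal of \<open>x\<close> vanishes; given that, bracketing with off-diagonal matrix
  units shows that \<open>x\<close> is constant along diagonals, with the value zero on every diagonal
  above the main one. The diagonals below it start in the vanishing part of the first column, and
  the main one vanishes because the trace does. The principal element \<open>h\<close> acts on the \<open>(i, j)\<close>
  entry by \<open>j - i\<close>; this gives weight one on the superdiagonal, and its eigenvalues range over the
  values of \<open>j - i\<close> at the positions allowed in the parabolic.
\<close>

section \<open>Entries and trace of a commutator\<close>

lemma index_mult_mat_sum:
  fixes A B :: "'a :: semiring_0 mat"
  assumes "A \<in> carrier_mat n m" "B \<in> carrier_mat m p" "i < n" "j < p"
  shows "(A * B) $$ (i, j) = (\<Sum>k<m. A $$ (i, k) * B $$ (k, j))"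
  using assms by (auto simp: scalar_prod_def atLeast0LessThan intro!: sum.cong)

lemma lie_bracket_carrier [simp, intro]:
  assumes "A \<in> carrier_mat n n" "B \<in> carrier_mat n n"
  shows "lie_bracket A B \<in> carrier_mat n n"
  using assms by (auto simp: lie_bracket_def intro!: minus_carrier_mat)

lemma dim_lie_bracket [simp]:
  "dim_row (lie_bracket A B) = dim_row B"
  "dim_col (lie_bracket A B) = dim_col A"
  by (simp_all add: lie_bracket_def)

lemma dim_mat_diag [simp]: "dim_row (mat_diag n d) = n" "dim_col (mat_diag n d) = n"
  by (simp_all add: mat_diag_def)

lemma index_lie_bracket:
  assumes "A \<in> carrier_mat n n" "B \<in> carrier_mat n n" "i < n" "j < n"
  shows "lie_bracket A B $$ (i, j) =
    (\<Sum>k<n. A $$ (i, k) * B $$ (k, j)) - (\<Sum>k<n. B $$ (i, k) * A $$ (k, j))"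
  using assms index_mult_mat_sum[OF assms] index_mult_mat_sum[OF assms(2,1,3,4)]
  by (simp add: lie_bracket_def)

lemma index_lie_bracket_mat_diag:
  assumes "A \<in> carrier_mat n n" "i < n" "j < n"
  shows "lie_bracket (mat_diag n d) A $$ (i, j) = (d i - d j) * A $$ (i, j)"
    and "lie_bracket A (mat_diag n d) $$ (i, j) = (d j - d i) * A $$ (i, j)"
  using assms by (simp_all add: lie_bracket_def mat_diag_mult_left mat_diag_mult_right algebra_simps)

lemma mat_trace_lie_bracket:
  assumes "A \<in> carrier_mat n n" "B \<in> carrier_mat n n"
  shows "mat_trace (lie_bracket A B) = 0"
proof -
  have "mat_trace (lie_bracket A B) = (\<Sum>i<n. lie_bracket A B $$ (i, i))"
    using assms by (simp add: mat_trace_def)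
  also have "\<dots> = (\<Sum>i<n. \<Sum>k<n. A $$ (i, k) * B $$ (k, i)) - (\<Sum>i<n. \<Sum>k<n. B $$ (i, k) * A $$ (k, i))"
    using assms by (simp add: index_lie_bracket sum_subtractf)
  also have "(\<Sum>i<n. \<Sum>k<n. A $$ (i, k) * B $$ (k, i)) = (\<Sum>i<n. \<Sum>k<n. B $$ (i, k) * A $$ (k, i))"
    by (subst sum.swap) (simp add: mult.commute)
  finally show ?thesis by simp
qed

section \<open>The parabolic as a Lie subalgebra\<close>

lemma mem_sl_iff: "A \<in> sl n \<longleftrightarrow> A \<in> carrier_mat n n \<and> (\<Sum>i<n. A $$ (i, i)) = 0"
  by (auto simp: sl_def mat_trace_def)

lemma mem_first_max_parabolic_iff:
  "A \<in> first_max_parabolic n \<longleftrightarrow>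
     A \<in> carrier_mat n n \<and> (\<Sum>i<n. A $$ (i, i)) = 0 \<and> (\<forall>i. 0 < i \<and> i < n \<longrightarrow> A $$ (i, 0) = 0)"
  by (auto simp: first_max_parabolic_def mem_sl_iff)

lemma lie_subalgebra_first_max_parabolic: "lie_subalgebra n (first_max_parabolic n)"
proof -
  have "lie_bracket x y \<in> first_max_parabolic n"
    if x: "x \<in> first_max_parabolic n" and y: "y \<in> first_max_parabolic n" for x y
  proof -
    have c: "x \<in> carrier_mat n n" "y \<in> carrier_mat n n"
      using x y by (auto simp: mem_first_max_parabolic_iff)
    \<comment> \<open>Every product has a vanishing factor from a first column:
      \<open>a $$ (i, 0)\<close> when \<open>k = 0\<close>, and \<open>b $$ (k, 0)\<close>
      otherwise.\<close>
    have z: "(\<Sum>k<n. a $$ (i, k) * b $$ (k, 0)) = 0"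
      if "a \<in> first_max_parabolic n" "b \<in> first_max_parabolic n" "0 < i" "i < n" for a b i
    proof (intro sum.neutral ballI)
      fix k assume "k \<in> {..<n}"
      with that show "a $$ (i, k) * b $$ (k, 0) = 0"
        by (cases "k = 0") (auto simp: mem_first_max_parabolic_iff)
    qed
    have "lie_bracket x y \<in> sl n"
      using c by (auto simp: sl_def mat_trace_lie_bracket)
    moreover have "lie_bracket x y $$ (i, 0) = 0" if "0 < i" "i < n" for i
      using that c z[OF x y that] z[OF y x that] by (simp add: index_lie_bracket)
    ultimately show ?thesis by (simp add: first_max_parabolic_def)
  qed
  then show ?thesis
    unfolding lie_subalgebra_def
    by (auto simp: mem_first_max_parabolic_iff sum.distrib simp flip: sum_distrib_left)
qed

section \<open>The superdiagonal functional and its values on brackets\<close>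

lemma superdiagonal_functional_add:
  assumes "A \<in> carrier_mat n n" "B \<in> carrier_mat n n"
  shows "superdiagonal_functional n (A + B) = superdiagonal_functional n A + superdiagonal_functional n B"
  using assms by (simp add: superdiagonal_functional_def sum.distrib)

lemma superdiagonal_functional_minus:
  assumes "A \<in> carrier_mat n n" "B \<in> carrier_mat n n"
  shows "superdiagonal_functional n (A - B) = superdiagonal_functional n A - superdiagonal_functional n B"
  using assms by (simp add: superdiagonal_functional_def sum_subtractf)

lemma superdiagonal_functional_smult:
  assumes "A \<in> carrier_mat n n"
  shows "superdiagonal_functional n (c \<cdot>\<^sub>m A) = c * superdiagonal_functional n A"
  using assms by (simp add: superdiagonal_functional_def sum_distrib_left)

definition matrix_unit :: "nat \<Rightarrow> nat \<Rightarrow> nat \<Rightarrow> complex mat" where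
  "matrix_unit n i j = mat n n (\<lambda>(k, l). if k = i \<and> l = j then 1 else 0)"

lemma matrix_unit_carrier [simp, intro]: "matrix_unit n i j \<in> carrier_mat n n"
  by (simp add: matrix_unit_def)

lemma index_matrix_unit [simp]:
  "k < n \<Longrightarrow> l < n \<Longrightarrow> matrix_unit n i j $$ (k, l) = (if k = i \<and> l = j then 1 else 0)"
  by (simp add: matrix_unit_def)

lemma matrix_unit_nonzero:
  assumes "i < n" "j < n"
  shows "matrix_unit n i j \<noteq> 0\<^sub>m n n"
proof
  assume "matrix_unit n i j = 0\<^sub>m n n"
  from arg_cong[OF this, of "\<lambda>A. A $$ (i, j)"] show False using assms by simp
qed

text \<open>An off-diagonal unit has trace zero, and \<open>0 < j\<close> keeps it out of the first
  column. A row index \<open>i\<close> outside the matrix gives the zero matrix.\<close>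

lemma matrix_unit_mem_parabolic:
  assumes "i \<noteq> j" "0 < j" "j < n"
  shows "matrix_unit n i j \<in> first_max_parabolic n"
  using assms by (auto simp: mem_first_max_parabolic_iff intro!: sum.neutral)

text \<open>Right multiplication by the unit puts column \<open>i\<close> of \<open>x\<close> into
  column \<open>j\<close>, which meets the superdiagonal in row \<open>j - 1\<close>. Left
  multiplication puts row \<open>j\<close> of \<open>x\<close> into row \<open>i\<close>, which
  meets it in column \<open>i + 1\<close>, unless row \<open>i\<close> is the last one.\<close>

lemma superdiagonal_functional_bracket_matrix_unit:
  assumes x: "x \<in> carrier_mat n n" and ij: "i < n" "0 < j" "j < n"
  shows "superdiagonal_functional n (lie_bracket x (matrix_unit n i j)) =
    x $$ (j - 1, i) - (if i + 1 < n then x $$ (j, i + 1) else 0)"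
proof -
  have "lie_bracket x (matrix_unit n i j) $$ (k, k + 1) =
      (if k = j - 1 then x $$ (j - 1, i) else 0) - (if k = i then x $$ (j, i + 1) else 0)"
    if "k < n - 1" for k
  proof -
    have k: "k < n" "k + 1 < n" using that by auto
    have "(\<Sum>l<n. x $$ (k, l) * matrix_unit n i j $$ (l, k + 1)) =
        (\<Sum>l<n. if l = i then (if k = j - 1 then x $$ (j - 1, i) else 0) else 0)"
      using k ij by (intro sum.cong) auto
    moreover have "(\<Sum>l<n. matrix_unit n i j $$ (k, l) * x $$ (l, k + 1)) =
        (\<Sum>l<n. if l = j then (if k = i then x $$ (j, i + 1) else 0) else 0)"
      using k ij by (intro sum.cong) auto
    ultimately show ?thesis
      using ij by (simp only: index_lie_bracket[OF x matrix_unit_carrier k]) simp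
  qed
  then have "superdiagonal_functional n (lie_bracket x (matrix_unit n i j)) =
     (\<Sum>k<n-1. (if k = j - 1 then x $$ (j - 1, i) else 0) - (if k = i then x $$ (j, i + 1) else 0))"
    by (simp add: superdiagonal_functional_def)
  also have "\<dots> = x $$ (j - 1, i) - (if i + 1 < n then x $$ (j, i + 1) else 0)"
    using ij by (auto simp: sum_subtractf)
  finally show ?thesis .
qed

lemma superdiagonal_functional_bracket_mat_diag:
  assumes "x \<in> carrier_mat n n"
  shows "superdiagonal_functional n (lie_bracket (mat_diag n d) x) =
      (\<Sum>i<n - 1. (d i - d (i + 1)) * x $$ (i, i + 1))"
    and "superdiagonal_functional n (lie_bracket x (mat_diag n d)) =
      (\<Sum>i<n - 1. (d (i + 1) - d i) * x $$ (i, i + 1))"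
  using assms by (simp_all add: superdiagonal_functional_def index_lie_bracket_mat_diag)

lemma mat_diag_mem_parabolic:
  assumes "(\<Sum>i<n. d i) = 0"
  shows "mat_diag n d \<in> first_max_parabolic n"
  using assms by (auto simp: mem_first_max_parabolic_iff mat_diag_def)

section \<open>Nondegeneracy of the form\<close>

lemma superdiagonal_form_nondegenerate:
  assumes x: "x \<in> first_max_parabolic n"
    and orth: "\<And>y. y \<in> first_max_parabolic n \<Longrightarrow> superdiagonal_functional n (lie_bracket x y) = 0"
  shows "x = 0\<^sub>m n n"
proof -
  have c: "x \<in> carrier_mat n n" and tr: "(\<Sum>i<n. x $$ (i, i)) = 0"
    and col: "\<And>i. 0 < i \<Longrightarrow> i < n \<Longrightarrow> x $$ (i, 0) = 0"
    using x by (auto simp: mem_first_max_parabolic_iff)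
  have super: "x $$ (m, m + 1) = 0" if m: "m + 1 < n" for m
  proof -
    txt \<open>Bracketing with a traceless diagonal matrix that jumps only between positions
      \<open>m\<close> and \<open>m + 1\<close> isolates the entry \<open>(m, m + 1)\<close>.\<close>
    define d :: "nat \<Rightarrow> complex" where
      "d k = (if k < m + 1 then 1 else 0) - of_nat (m + 1) / of_nat n" for k
    have "{..<n} \<inter> {k. k < m + 1} = {..<m + 1}" using m by auto
    then have "(\<Sum>k<n. if k < m + 1 then 1 else 0 :: complex) = of_nat (m + 1)"
      by (simp add: sum.If_cases)
    then have "(\<Sum>k<n. d k) = 0"
      using m by (simp add: d_def sum_subtractf)
    then have "0 = (\<Sum>i<n - 1. (d (i + 1) - d i) * x $$ (i, i + 1))"
      using orth[OF mat_diag_mem_parabolic] superdiagonal_functional_bracket_mat_diag(2)[OF c] by simp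
    also have "\<dots> = (\<Sum>i<n - 1. if i = m then - x $$ (m, m + 1) else 0)"
      by (intro sum.cong) (auto simp: d_def)
    also have "\<dots> = - x $$ (m, m + 1)" using m by simp
    finally show ?thesis by simp
  qed
  \<comment> \<open>The test element is the unit at \<open>(b, a + 1)\<close>. For
    \<open>b = a + 1\<close> it would be diagonal with trace one, hence outside the parabolic; there
    the entries compared lie on the superdiagonal, where \<open>super\<close> applies.\<close>
  have shift: "x $$ (a, b) = (if b + 1 < n then x $$ (a + 1, b + 1) else 0)"
    if ab: "a + 1 < n" "b < n" for a b
  proof (cases "b = a + 1")
    case True
    then show ?thesis using super[of a] super[of b] ab by auto
  next
    case False
    have "superdiagonal_functional n (lie_bracket x (matrix_unit n b (a + 1))) = 0"
      using ab False by (intro orth matrix_unit_mem_parabolic) auto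
    then show ?thesis
      using ab by (subst (asm) superdiagonal_functional_bracket_matrix_unit[OF c]) auto
  qed
  have upper: "x $$ (a, b) = 0" if "a < b" "b < n" for a b
    using that
  \<comment> \<open>The induction follows a diagonal down to the last column, where
    \<open>shift\<close> gives zero; the base case contradicts \<open>b < n\<close>.\<close>
  proof (induction "n - b" arbitrary: a b)
    case (Suc t)
    show ?case
    proof (cases "b + 1 < n")
      case True
      have "x $$ (a + 1, b + 1) = 0" using Suc.hyps(2) Suc.prems True by (intro Suc.hyps(1)) auto
      then show ?thesis using shift[of a b] Suc.prems by auto
    next
      case False
      then show ?thesis using shift[of a b] Suc.prems by auto
    qed
  qed simp
  have lower: "x $$ (a, b) = 0" if "b < a" "a < n" for a b
    using that
  \<comment> \<open>Here the diagonal is followed upwards, ending in the first column.\<close>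
  proof (induction b arbitrary: a)
    case 0
    then show ?case using col by simp
  next
    case (Suc b)
    have "x $$ (a - 1, b) = 0" using Suc.prems by (intro Suc.IH) auto
    then show ?case using shift[of "a - 1" b] Suc.prems by auto
  qed
  have const: "x $$ (a, a) = x $$ (0, 0)" if "a < n" for a
    using that
  proof (induction a)
    case (Suc a)
    then show ?case using shift[of a a] by auto
  qed simp
  have "(\<Sum>i<n. x $$ (i, i)) = (\<Sum>i<n. x $$ (0, 0))"
    by (intro sum.cong refl const) auto
  with tr have "of_nat n * x $$ (0, 0) = 0"
    by simp
  \<comment> \<open>An index \<open>a < n\<close> makes \<open>n\<close> nonzero, so the factor
    \<open>of_nat n\<close> cancels.\<close>
  then have "x $$ (a, a) = 0" if "a < n" for a
    using const[OF that] that by auto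
  then have "x $$ (a, b) = 0" if "a < n" "b < n" for a b
    using upper lower that by (cases a b rule: linorder_cases) auto
  then show ?thesis using c by (intro eq_matI) auto
qed

lemma frobenius_superdiagonal_functional:
  "frobenius_functional n (first_max_parabolic n) (superdiagonal_functional n)"
proof -
  have "first_max_parabolic n \<subseteq> carrier_mat n n"
    by (auto simp: mem_first_max_parabolic_iff)
  then have "linear_functional_on (first_max_parabolic n) (superdiagonal_functional n)"
    unfolding linear_functional_on_def
    by (blast intro: superdiagonal_functional_add superdiagonal_functional_smult)
  then show ?thesis
    unfolding frobenius_functional_def
    using lie_subalgebra_first_max_parabolic superdiagonal_form_nondegenerate by blast
qed

section \<open>The principal element\<close>

lemma lie_bracket_minus_left:
  assumes "A \<in> carrier_mat n n" "B \<in> carrier_mat n n" "C \<in> carrier_mat n n"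
  shows "lie_bracket (A - B) C = lie_bracket A C - lie_bracket B C"
  using assms
  by (intro eq_matI)
     (auto simp: index_lie_bracket[of _ n] minus_carrier_mat algebra_simps sum_subtractf)

text \<open>The difference of two candidates is orthogonal to the whole parabolic, so nondegeneracy
  makes them equal.\<close>

lemma principal_element_superdiagonal_eqI:
  assumes h: "h \<in> first_max_parabolic n"
    and eq: "\<And>x. x \<in> first_max_parabolic n \<Longrightarrow>
      superdiagonal_functional n x = superdiagonal_functional n (lie_bracket h x)"
  shows "principal_element (first_max_parabolic n) (superdiagonal_functional n) = h"
  unfolding principal_element_def
proof (rule the_equality)
  fix g
  assume g: "g \<in> first_max_parabolic n \<and> (\<forall>x\<in>first_max_parabolic n.
    superdiagonal_functional n x = superdiagonal_functional n (lie_bracket g x))"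
  have c: "g \<in> carrier_mat n n" "h \<in> carrier_mat n n"
    using g h by (auto simp: mem_first_max_parabolic_iff)
  have "g - h = 0\<^sub>m n n"
  proof (rule superdiagonal_form_nondegenerate)
    show "g - h \<in> first_max_parabolic n"
      using g h by (auto simp: mem_first_max_parabolic_iff sum_subtractf)
    fix y assume y: "y \<in> first_max_parabolic n"
    then have "y \<in> carrier_mat n n" by (simp add: mem_first_max_parabolic_iff)
    then show "superdiagonal_functional n (lie_bracket (g - h) y) = 0"
      using g y eq[OF y] c
      by (auto simp: lie_bracket_minus_left[of _ n] superdiagonal_functional_minus)
  qed
  then have "(g - h) $$ (i, j) = 0" if "i < n" "j < n" for i j
    using that by simp
  then show "g = h" using c by (intro eq_matI) auto
qed (use assms in auto)

lemma smult_mat_diag: "(c :: 'a :: mult_zero) \<cdot>\<^sub>m mat_diag n d = mat_diag n (\<lambda>i. c * d i)"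
  by (intro eq_matI) (auto simp: mat_diag_def)

lemma sum_principal_weights: "(\<Sum>i<n. of_int (int n - 1 - 2 * int i) :: 'a :: comm_ring_1) = 0"
proof -
  \<comment> \<open>Separating the upper limit \<open>m\<close> from \<open>n\<close> makes the
    induction possible; the closed form vanishes at \<open>m = n\<close>.\<close>
  have "(\<Sum>i<m. int n - 1 - 2 * int i) = int m * (int n - int m)" for m
    by (induction m) (auto simp: algebra_simps)
  from this[of n] show ?thesis
    by (simp only: of_int_sum[symmetric]) simp
qed

lemma principal_element_superdiagonal:
  "principal_element (first_max_parabolic n) (superdiagonal_functional n) =
     (1 / 2) \<cdot>\<^sub>m mat_diag n (\<lambda>i. of_int (int n - 1 - 2 * int i))"
proof (rule principal_element_superdiagonal_eqI)
  show "(1 / 2) \<cdot>\<^sub>m mat_diag n (\<lambda>i. of_int (int n - 1 - 2 * int i)) \<in> first_max_parabolic n"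
    unfolding smult_mat_diag
    by (intro mat_diag_mem_parabolic) (simp only: sum_distrib_left[symmetric] sum_principal_weights mult_zero_right)
next
  fix x assume "x \<in> first_max_parabolic n"
  then have "x \<in> carrier_mat n n" by (simp add: mem_first_max_parabolic_iff)
  then show "superdiagonal_functional n x = superdiagonal_functional n
      (lie_bracket ((1 / 2) \<cdot>\<^sub>m mat_diag n (\<lambda>i. of_int (int n - 1 - 2 * int i))) x)"
    unfolding smult_mat_diag
    by (subst superdiagonal_functional_bracket_mat_diag(1))
       (auto simp: superdiagonal_functional_def field_simps)
qed

section \<open>The standard triple of the principal three-dimensional subalgebra\<close>

lemma principal_standard_triple:
  assumes "n \<ge> 2"
  shows "\<exists>f. standard_triple n (principal_nilpotent n) (principal_semisimple n) f"
proof -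
  let ?e = "principal_nilpotent n"
  let ?h = "principal_semisimple n"
  txt \<open>The weights \<open>i (n - i)\<close> are the partial sums of the diagonal entries of \<open>h\<close>.\<close>
  define w :: "nat \<Rightarrow> complex" where "w i = of_nat i * (of_nat n - of_nat i)" for i
  define f :: "complex mat" where
    "f = mat n n (\<lambda>(i, j). if i = j + 1 then w i else 0)"
  have c: "?e \<in> carrier_mat n n" "?h \<in> carrier_mat n n" "f \<in> carrier_mat n n"
    by (auto simp: principal_nilpotent_def principal_semisimple_def f_def)
  have e_ix: "?e $$ (i, j) = (if j = i + 1 then 1 else 0)" if "i < n" "j < n" for i j
    using that by (simp add: principal_nilpotent_def)
  have f_ix: "f $$ (i, j) = (if i = j + 1 then w i else 0)" if "i < n" "j < n" for i j
    using that by (simp add: f_def)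
  have "?e \<noteq> 0\<^sub>m n n"
  proof
    assume "?e = 0\<^sub>m n n"
    from arg_cong[OF this, of "\<lambda>A. A $$ (0, 1)"] show False using assms by (simp add: e_ix)
  qed
  moreover have "?e \<in> sl n" "f \<in> sl n"
    using c by (auto simp: mem_sl_iff e_ix f_ix)
  moreover have "?h \<in> sl n"
    using c sum_principal_weights[where 'a = complex and n = n]
    by (auto simp: mem_sl_iff principal_semisimple_def mat_diag_def)
  moreover have "lie_bracket ?h ?e = 2 \<cdot>\<^sub>m ?e"
    using c(1) unfolding principal_semisimple_def
    by (intro eq_matI) (auto simp: index_lie_bracket_mat_diag e_ix)
  moreover have "lie_bracket ?h f = (- 2) \<cdot>\<^sub>m f"
    using c(3) unfolding principal_semisimple_def
    by (intro eq_matI) (auto simp: index_lie_bracket_mat_diag f_ix)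
  moreover have "lie_bracket ?e f = ?h"
  proof (rule eq_matI)
    fix i j assume "i < dim_row ?h" "j < dim_col ?h"
    then have ij: "i < n" "j < n" using c by auto
    have "(\<Sum>k<n. ?e $$ (i, k) * f $$ (k, j)) = (\<Sum>k<n. if k = i + 1 then (if i = j then w (i + 1) else 0) else 0)"
      using ij by (intro sum.cong) (auto simp: e_ix f_ix)
    also have "\<dots> = (if i = j then w (i + 1) else 0)"
    \<comment> \<open>In the last row the sum is empty of nonzero terms, which agrees with the
      formula because \<open>w n = 0\<close>.\<close>
    proof (cases "i + 1 < n")
      case False
      then have "i + 1 = n" using ij by simp
      then show ?thesis by (auto simp: w_def)
    qed simp
    finally have ef: "(\<Sum>k<n. ?e $$ (i, k) * f $$ (k, j)) = (if i = j then w (i + 1) else 0)" .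
    \<comment> \<open>At \<open>i = 0\<close> the subtraction \<open>i - 1\<close> truncates to
      \<open>0\<close>; this is harmless because \<open>w 0 = 0\<close>.\<close>
    have "(\<Sum>k<n. f $$ (i, k) * ?e $$ (k, j)) = (\<Sum>k<n. if k = i - 1 then (if i = j then w i else 0) else 0)"
      using ij by (intro sum.cong) (auto simp: e_ix f_ix w_def)
    also have "\<dots> = (if i = j then w i else 0)"
      using ij by auto
    finally have fe: "(\<Sum>k<n. f $$ (i, k) * ?e $$ (k, j)) = (if i = j then w i else 0)" .
    show "lie_bracket ?e f $$ (i, j) = ?h $$ (i, j)"
      using ij c by (simp add: index_lie_bracket[of _ n] ef fe)
        (simp add: principal_semisimple_def mat_diag_def w_def algebra_simps)
  qed (use c in auto)
  ultimately show ?thesis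
    unfolding standard_triple_def by blast
qed

section \<open>The spectrum of the adjoint action on the parabolic\<close>

text \<open>Only differences of diagonal entries enter the adjoint action, so the hypothesis fixes
  \<open>d\<close> just up to a scalar matrix. Any nonzero entry of an eigenvector determines its
  eigenvalue.\<close>

lemma eigenvalues_on_parabolic:
  assumes n: "n \<ge> 2" and d: "\<And>i j. i < n \<Longrightarrow> j < n \<Longrightarrow> d i - d j = of_int (int j - int i)"
  shows "eigenvalues_on n (first_max_parabolic n) (lie_bracket (mat_diag n d)) =
    of_int ` {2 - int n..int n - 1}"
proof (intro equalityI subsetI)
  fix c assume "c \<in> eigenvalues_on n (first_max_parabolic n) (lie_bracket (mat_diag n d))"
  then obtain x where x: "x \<in> first_max_parabolic n" "x \<noteq> 0\<^sub>m n n"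
    and ev: "lie_bracket (mat_diag n d) x = c \<cdot>\<^sub>m x"
    by (auto simp: eigenvalues_on_def)
  have xc: "x \<in> carrier_mat n n" using x by (simp add: mem_first_max_parabolic_iff)
  have "\<exists>i<n. \<exists>j<n. x $$ (i, j) \<noteq> 0"
  proof (rule ccontr)
    assume "\<not> ?thesis"
    then have "x = 0\<^sub>m n n" using xc by (intro eq_matI) auto
    with x show False by simp
  qed
  then obtain i j where ij: "i < n" "j < n" "x $$ (i, j) \<noteq> 0" by auto
  have "(d i - d j) * x $$ (i, j) = c * x $$ (i, j)"
    using arg_cong[OF ev, of "\<lambda>A. A $$ (i, j)"] ij xc
    by (simp add: index_lie_bracket_mat_diag)
  then have "c = of_int (int j - int i)" using ij d by simp
  \<comment> \<open>With the first column excluded below its top entry, \<open>j - i\<close> is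
    smallest at \<open>(n - 1, 1)\<close>, whence the bound \<open>2 - n\<close>.\<close>
  moreover have "j \<noteq> 0 \<or> i = 0"
    using ij x by (auto simp: mem_first_max_parabolic_iff)
  then have "int j - int i \<in> {2 - int n..int n - 1}" using ij n by auto
  ultimately show "c \<in> of_int ` {2 - int n..int n - 1}" by blast
next
  \<comment> \<open>A nonzero element supported on a single diagonal is an eigenvector.\<close>
  have diff: "c \<in> eigenvalues_on n (first_max_parabolic n) (lie_bracket (mat_diag n d))"
    if "x \<in> first_max_parabolic n" "x \<noteq> 0\<^sub>m n n"
      and "\<And>i j. i < n \<Longrightarrow> j < n \<Longrightarrow> x $$ (i, j) \<noteq> 0 \<Longrightarrow> of_int (int j - int i) = c" for x c
  proof -
    have xc: "x \<in> carrier_mat n n" using that by (simp add: mem_first_max_parabolic_iff)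
    have "lie_bracket (mat_diag n d) x = c \<cdot>\<^sub>m x"
    proof (rule eq_matI)
      fix i j assume "i < dim_row (c \<cdot>\<^sub>m x)" "j < dim_col (c \<cdot>\<^sub>m x)"
      then have ij: "i < n" "j < n" using xc by auto
      then show "lie_bracket (mat_diag n d) x $$ (i, j) = (c \<cdot>\<^sub>m x) $$ (i, j)"
        using xc d[OF ij] that(3)[OF ij]
        by (cases "x $$ (i, j) = 0") (simp_all add: index_lie_bracket_mat_diag)
    qed (use xc in auto)
    then show ?thesis using that by (auto simp: eigenvalues_on_def)
  qed
  fix c :: complex assume "c \<in> of_int ` {2 - int n..int n - 1}"
  then obtain m where m: "c = of_int m" "2 - int n \<le> m" "m \<le> int n - 1" by auto
  have unit: "c \<in> eigenvalues_on n (first_max_parabolic n) (lie_bracket (mat_diag n d))"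
    if "i \<noteq> j" "i < n" "0 < j" "j < n" "m = int j - int i" for i j
    using that m(1)
    by (intro diff[of "matrix_unit n i j"] matrix_unit_mem_parabolic matrix_unit_nonzero)
       (auto split: if_splits)
  consider "m > 0" | "m < 0" | "m = 0" by linarith
  then show "c \<in> eigenvalues_on n (first_max_parabolic n) (lie_bracket (mat_diag n d))"
  proof cases
    case 1
    then show ?thesis using m n by (intro unit[of 0 "nat m"]) auto
  next
    case 2
    \<comment> \<open>Column \<open>1\<close> is the first one allowed below the diagonal;
      \<open>m \<ge> 2 - n\<close> keeps row \<open>1 - m\<close> inside the matrix.\<close>
    then show ?thesis using m n by (intro unit[of "nat (1 - m)" 1]) auto
  next
    case 3
    \<comment> \<open>A single diagonal unit is not traceless, so the witness is the principal
      semisimple element; its top entry \<open>n - 1\<close> is nonzero since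
      \<open>n \<ge> 2\<close>.\<close>
    let ?g = "\<lambda>i. of_int (int n - 1 - 2 * int i) :: complex"
    show ?thesis
    proof (rule diff)
      show "mat_diag n ?g \<in> first_max_parabolic n"
        by (intro mat_diag_mem_parabolic sum_principal_weights)
      show "mat_diag n ?g \<noteq> 0\<^sub>m n n"
      proof
        assume "mat_diag n ?g = 0\<^sub>m n n"
        from arg_cong[OF this, of "\<lambda>A. A $$ (0, 0)"] have "of_int (int n - 1) = (0 :: complex)"
          using n by (simp add: mat_diag_def)
        then show False using n by (simp only: of_int_eq_0_iff)
      qed
    qed (use 3 m in \<open>auto simp: mat_diag_def split: if_splits\<close>)
  qed
qed

theorem mainTheorem6:
  fixes n :: nat
  assumes "n \<ge> 2"
  shows "frobenius_functional n (first_max_parabolic n) (superdiagonal_functional n) \<and>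
         principal_element (first_max_parabolic n) (superdiagonal_functional n) =
           (1 / 2) \<cdot>\<^sub>m mat_diag n (\<lambda>i. of_int (int n - 1 - 2 * int i)) \<and>
         (\<exists>S h. principal_tds n S h \<and>
           principal_element (first_max_parabolic n) (superdiagonal_functional n) = (1 / 2) \<cdot>\<^sub>m h) \<and>
         eigenvalues_on n (first_max_parabolic n)
           (lie_bracket (principal_element (first_max_parabolic n) (superdiagonal_functional n))) =
           of_int ` {2 - int n..int n - 1}"
proof (intro conjI)
  show "\<exists>S h. principal_tds n S h \<and>
      principal_element (first_max_parabolic n) (superdiagonal_functional n) = (1 / 2) \<cdot>\<^sub>m h"
    using principal_standard_triple[OF assms]
    unfolding principal_tds_def principal_element_superdiagonal principal_semisimple_def by blast
  show "eigenvalues_on n (first_max_parabolic n)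
      (lie_bracket (principal_element (first_max_parabolic n) (superdiagonal_functional n))) =
      of_int ` {2 - int n..int n - 1}"
    \<comment> \<open>The halved weights at \<open>i\<close> and \<open>j\<close> differ by exactly
      \<open>j - i\<close>.\<close>
    unfolding principal_element_superdiagonal smult_mat_diag
    by (rule eigenvalues_on_parabolic[OF assms]) (simp add: field_simps)
qed (rule frobenius_superdiagonal_functional principal_element_superdiagonal)+

end
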